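(* Fix $\boldsymbol{\mu}\in\mathbb{R}^n$, a positive definite matrix $P\in\mathbb{R}^{n\times n}$, $\boldsymbol{a}\in\mathbb{R}^n$ with $\boldsymbol{a}^\top P\boldsymbol{a}>0$, and $b\in\mathbb{R}$, and for $\lambda>0$ and $R\ge 0$ define $$F(\lambda,R)=1+\frac1\lambda\left\{\ln\left(1-(1-e^{-\lambda})\,\operatorname{cdf}\left(\frac{b-\boldsymbol{a}^\top\boldsymbol{\mu}}{\sqrt{\boldsymbol{a}^\top P\boldsymbol{a}}}\right)\right)+R\right\}.$$ Let $(R_j)_{j\ge1}$ be a sequence in $[0,\infty)$ and, for each $j$, let $\lambda_j^*>0$ be a minimizer of $\lambda\mapsto F(\lambda,R_j)$ over $(0,\infty)$. If $\lambda_j^*\to 0$ as $j\to\infty$, then $R_j\to 0$ and $$\lim_{j\to\infty}F(\lambda_j^*,R_j)=1-\operatorname{cdf}\left(\frac{b-\boldsymbol{a}^\top\boldsymbol{\mu}}{\sqrt{\boldsymbol{a}^\top P\boldsymbol{a}}}\right).$$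
   Context: $\operatorname{cdf}(\cdot)$ is the standard normal cumulative distribution function. $F(\lambda,R)$ is the upper bound on the risk probability $\mathbb{P}_{\boldsymbol{x}\sim\pi}[\boldsymbol{a}^\top\boldsymbol{x}>b]$ for a density $\pi$ whose relative entropy with respect to the Gaussian reference $\mathcal{N}(\boldsymbol{\mu},P)$ equals $R$; the limit value is the exact risk probability $\mathbb{P}[\boldsymbol{a}^\top\boldsymbol{x}>b]$ under $\boldsymbol{x}\sim\mathcal{N}(\boldsymbol{\mu},P)$. *)

theory Defs
  imports "HOL-Probability.Probability"
begin

(* Positive definiteness includes symmetry: P is the covariance matrix of a Gaussian law. *)
definition positive_definite :: "real ^ 'n ^ 'n \<Rightarrow> bool" where
  "positive_definite P \<longleftrightarrow> transpose P = P \<and> (\<forall>x. x \<noteq> 0 \<longrightarrow> x \<bullet> (P *v x) > 0)"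

(* For x distributed as N(mu, P), this is the value with P[a . x <= b] = cdf of the
   standard normal law at that value. *)
definition normalized_threshold ::
  "real ^ 'n \<Rightarrow> real ^ 'n ^ 'n \<Rightarrow> real ^ 'n \<Rightarrow> real \<Rightarrow> real" where
  "normalized_threshold \<mu> P a b = (b - a \<bullet> \<mu>) / sqrt (a \<bullet> (P *v a))"

definition risk_bound ::
  "real ^ 'n \<Rightarrow> real ^ 'n ^ 'n \<Rightarrow> real ^ 'n \<Rightarrow> real \<Rightarrow> real \<Rightarrow> real \<Rightarrow> real" where
  "risk_bound \<mu> P a b l R =
     1 + (1 / l) *
       (ln (1 - (1 - exp (- l)) * cdf std_normal_distribution (normalized_threshold \<mu> P a b)) + R)"

end

theory Submission
  imports Defs
begin

text \<open>
  Write \<open>p\<close> for the value of the normal distribution function and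
  \<open>g l = ln (1 - (1 - exp (- l)) * p)\<close>, so that the bound is \<open>1 + (g l + R) / l\<close>.
  Here \<open>g\<close> is the cumulant generating function, at \<open>- l\<close>, of the indicator of the event of
  probability \<open>p\<close>; it is smooth at the origin, with \<open>g 0 = 0\<close> and \<open>g' 0 = - p\<close>.

  A minimizer in the open half-line is a critical point, and the critical point equation of
  \<open>(g l + R) / l\<close> determines both quantities of interest as functions of the minimizer alone:
  \<open>R = l * g' l - g l\<close> and, after substituting, the minimal value \<open>1 + g' l\<close>
  (lemma \<open>minimizer_of_quotient\<close>). Both expressions are continuous in \<open>l\<close> up to the origin,
  so along minimizers tending to \<open>0\<close> they tend to \<open>0\<close> and to \<open>1 - p\<close>
  (lemma \<open>minimizers_tendsto_0\<close>).
\<close>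

text \<open>
  The point \<open>l\<close> is interior to the half-line, so the derivative
  \<open>(l * g' - (g l + R)) / l\<^sup>2\<close> of the quotient vanishes there.
\<close>

lemma minimizer_of_quotient:
  fixes g :: "real \<Rightarrow> real"
  assumes deriv: "(g has_real_derivative g') (at l)"
    and pos: "l > 0"
    and min: "\<And>y. y > 0 \<Longrightarrow> (g l + R) / l \<le> (g y + R) / y"
  shows "R = l * g' - g l" and "(g l + R) / l = g'"
proof -
  have "((\<lambda>y. (g y + R) / y) has_real_derivative (g' * l - (g l + R)) / (l * l)) (at l)"
    using pos by (auto intro!: derivative_eq_intros deriv)
  moreover have "\<forall>y. \<bar>l - y\<bar> < l \<longrightarrow> (g l + R) / l \<le> (g y + R) / y"
    using min by auto
  ultimately have "(g' * l - (g l + R)) / (l * l) = 0"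
    using pos by (intro DERIV_local_min)
  then show R: "R = l * g' - g l"
    using pos by (simp add: algebra_simps)
  show "(g l + R) / l = g'"
    using pos by (simp add: R)
qed

lemma minimizers_tendsto_0:
  fixes g g' :: "real \<Rightarrow> real" and R l :: "nat \<Rightarrow> real"
  assumes deriv: "\<And>x. x > 0 \<Longrightarrow> (g has_real_derivative g' x) (at x)"
    and cont: "isCont g 0" "isCont g' 0" and g0: "g 0 = 0"
    and pos: "eventually (\<lambda>j. l j > 0) sequentially"
    and min: "eventually (\<lambda>j. \<forall>y>0. (g (l j) + R j) / l j \<le> (g y + R j) / y) sequentially"
    and lim: "l \<longlonglongrightarrow> 0"
  shows "R \<longlonglongrightarrow> 0" and "(\<lambda>j. (g (l j) + R j) / l j) \<longlonglongrightarrow> g' 0"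
proof -
  have lim_g: "(\<lambda>j. g (l j)) \<longlonglongrightarrow> 0" and lim_g': "(\<lambda>j. g' (l j)) \<longlonglongrightarrow> g' 0"
    using isCont_tendsto_compose[OF cont(1) lim] isCont_tendsto_compose[OF cont(2) lim] g0
    by simp_all
  have "(\<lambda>j. l j * g' (l j) - g (l j)) \<longlonglongrightarrow> 0 * g' 0 - 0"
    by (intro tendsto_intros lim lim_g lim_g')
  moreover have "eventually (\<lambda>j. l j * g' (l j) - g (l j) = R j) sequentially"
    using pos min by eventually_elim (metis minimizer_of_quotient(1) deriv)
  ultimately show "R \<longlonglongrightarrow> 0"
    by (simp add: tendsto_cong)
  have "eventually (\<lambda>j. g' (l j) = (g (l j) + R j) / l j) sequentially"
    using pos min by eventually_elim (metis minimizer_of_quotient(2) deriv)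
  with lim_g' show "(\<lambda>j. (g (l j) + R j) / l j) \<longlonglongrightarrow> g' 0"
    by (rule Lim_transform_eventually)
qed

text \<open>
  The argument of the logarithm is the convex combination \<open>(1 - p) * 1 + p * exp (- l)\<close> of
  the positive numbers \<open>1\<close> and \<open>exp (- l)\<close>; this is where \<open>p\<close> has to be a probability.
\<close>

lemma log_argument_pos:
  fixes p l :: real
  assumes "0 \<le> p" "p \<le> 1"
  shows "0 < 1 - (1 - exp (- l)) * p"
proof (cases "p = 1")
  case False
  then have "0 < (1 - p) + p * exp (- l)"
    using assms by (intro add_pos_nonneg) auto
  then show ?thesis by (simp add: algebra_simps)
qed simp

theorem mainTheorem3:
  fixes \<mu> a :: "real ^ 'n" and P :: "real ^ 'n ^ 'n" and b :: real
    and R lstar :: "nat \<Rightarrow> real"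
  assumes "positive_definite P"
    and "a \<bullet> (P *v a) > 0"
    and "\<And>j. j \<ge> 1 \<Longrightarrow> R j \<ge> 0"
    and "\<And>j. j \<ge> 1 \<Longrightarrow> is_arg_min (\<lambda>l. risk_bound \<mu> P a b l (R j)) (\<lambda>l. l > 0) (lstar j)"
    and "lstar \<longlonglongrightarrow> 0"
  shows "R \<longlonglongrightarrow> 0 \<and>
    (\<lambda>j. risk_bound \<mu> P a b (lstar j) (R j))
      \<longlonglongrightarrow> 1 - cdf std_normal_distribution (normalized_threshold \<mu> P a b)"
proof -
  define p where "p = cdf std_normal_distribution (normalized_threshold \<mu> P a b)"
  define g where "g l = ln (1 - (1 - exp (- l)) * p)" for l
  define g' where "g' l = - (exp (- l) * p) / (1 - (1 - exp (- l)) * p)" for l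
  interpret real_distribution std_normal_distribution
    by (rule real_dist_normal_dist)
  have p: "0 \<le> p" "p \<le> 1"
    unfolding p_def by (rule cdf_nonneg, rule cdf_bounded_prob)
  note arg_pos = log_argument_pos[OF p]
  have bound: "risk_bound \<mu> P a b l r = 1 + (g l + r) / l" for l r
    by (simp add: risk_bound_def g_def p_def)
  have deriv: "(g has_real_derivative g' l) (at l)" for l
    unfolding g_def g'_def using arg_pos[of l]
    by (auto intro!: derivative_eq_intros)
  have "isCont g 0"
    using deriv by (rule DERIV_isCont)
  moreover have "isCont g' 0"
    unfolding g'_def by (intro continuous_intros) simp
  moreover have "g 0 = 0"
    by (simp add: g_def)
  moreover have "eventually (\<lambda>j. lstar j > 0) sequentially"
    using eventually_ge_at_top[of 1]
    by eventually_elim (use assms(4) in \<open>simp add: is_arg_min_def\<close>)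
  moreover have "eventually (\<lambda>j. \<forall>y>0. (g (lstar j) + R j) / lstar j \<le> (g y + R j) / y) sequentially"
    using eventually_ge_at_top[of 1]
    by eventually_elim (use assms(4) in \<open>auto simp: is_arg_min_linorder bound\<close>)
  ultimately have R: "R \<longlonglongrightarrow> 0" and min: "(\<lambda>j. (g (lstar j) + R j) / lstar j) \<longlonglongrightarrow> g' 0"
    using minimizers_tendsto_0[OF deriv] assms(5) by blast+
  have "(\<lambda>j. risk_bound \<mu> P a b (lstar j) (R j)) \<longlonglongrightarrow> 1 + g' 0"
    unfolding bound by (intro tendsto_intros min)
  then show ?thesis
    using R by (simp add: g'_def p_def)
qed

end
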